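(* Let $p/q$ be a rational number in lowest terms with $q>0$. If $p/q$ is an integer, write $p/q=a_0=[a_0]$ and set $k=0$ (empty word $\mathbf a$); otherwise write $p/q=[a_0;\mathbf a]=[a_0;a_1,\ldots,a_k]$ with $k>0$ and $a_k>1$. Let $(x_n)_{n\ge1}$ be a sequence of positive integers with $x_1=q$ having the strong Engel property $x_n^2\mid x_{n+1}$ for all $n\geq1$, and set $z_j=x_j/x_{j-1}^2\in\mathbb Z_{>0}$ for $j\ge2$. Let $\varepsilon_j\in\{+1,-1\}$ ($j\ge2$) be an arbitrary sequence of signs, and assume the series $$S=\frac{p}{q}+\sum_{n=2}^\infty\frac{\varepsilon_n}{x_n}$$ converges. Define finite continued fractions $\Phi_1=[a_0;\mathbf a]$, $\Phi_2=\varphi_{z_2}^{(\varepsilon_2(-1)^k)}(\Phi_1)$ and $\Phi_{n+1}=\varphi_{z_{n+1}}^{(\varepsilon_{n+1})}(\Phi_n)$ for $n\ge2$. Then for every $n\ge1$ the partial sum $S_n=p/q+\sum_{j=2}^n\varepsilon_j/x_j$ equals $\Phi_n$, and the continued fraction expansion of $S$ is the limit of the $\Phi_n$, i.e. $$S=\cdots\varphi_{z_4}^{(\varepsilon_4)}\varphi_{z_3}^{(\varepsilon_3)}\varphi_{z_2}^{(\varepsilon_2(-1)^k)}([a_0;\mathbf a]).$$ Suppose further that $k>0$, that $z_j>1$ for all $j\ge2$, and that $a_1>2$ if $k=1$ while $a_1>1$ if $k\ge2$. Then the length of the continued fraction $\Phi_n$ for $S_n$ is $\ell_n=(k+2)2^{n-1}-2$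 for all $n\ge1$.
   Context: A finite regular continued fraction is $[a_0;a_1,\ldots,a_n]=a_0+1/(a_1+1/(\cdots+1/a_n))$ with $a_0\in\mathbb Z$, $a_i\in\mathbb Z_{>0}$; its length is $\ell([a_0;a_1,\ldots,a_n])=n$ (the integer part is not counted). For the word $\mathbf a=(a_1,\ldots,a_n)$ with $n\ge1$, let $\mathbf a^R=(a_n,\ldots,a_1)$ be its reversal, $\tilde{\mathbf a}=(a_1,\ldots,a_{n-1},a_n-1,1)$, and $\tilde{\mathbf a}^R$ the reversal of $\tilde{\mathbf a}$. For a positive integer $z$ define the folding operators $\varphi_z^{(+1)}([a_0;\mathbf a])=[a_0;\mathbf a,z-1,\tilde{\mathbf a}^R]$ and $\varphi_z^{(-1)}([a_0;\mathbf a])=[a_0;\tilde{\mathbf a},z-1,\mathbf a^R]$. For the empty word ($n=0$): $\varphi_z^{(+1)}([a_0])=[a_0;z-1,1]$ and $\varphi_z^{(-1)}([a_0])=[a_0-1;1,z-1]$. Whenever a zero partial quotient appears in the output (e.g. when $z=1$ or $a_n=1$), it is understood to be removed using the concatenation rule $[\ldots,A,0,B,\ldots]=[\ldots,A+B,\ldots]$ (here $A$ may be the integer part), which reduces the length by $2$. *)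

theory Defs
  imports Complex_Main
begin

text \<open>
  A finite continued fraction \<open>[a\<^sub>0; a\<^sub>1, \<dots>, a\<^sub>n]\<close> is the nonempty list
  \<open>[a\<^sub>0, a\<^sub>1, \<dots>, a\<^sub>n]\<close>: the head is the integer part, the tail is the word of
  partial quotients.
\<close>

definition regular_cf :: "int list \<Rightarrow> bool" where
  "regular_cf c \<longleftrightarrow> c \<noteq> [] \<and> (\<forall>b \<in> set (tl c). b > 0)"

fun cf_value :: "int list \<Rightarrow> real" where
  "cf_value [] = 0"
| "cf_value [a] = of_int a"
| "cf_value (a # b # w) = of_int a + 1 / cf_value (b # w)"

definition cf_length :: "int list \<Rightarrow> nat" where
  "cf_length c = length (tl c)"

definition tilde :: "int list \<Rightarrow> int list" where
  "tilde a = butlast a @ [last a - 1, 1]"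

text \<open>
  Removal of zero partial quotients by \<open>[\<dots>, A, 0, B, \<dots>] = [\<dots>, A + B, \<dots>]\<close>; the
  head of the whole list, being the integer part, is never removed by this rule.
  A zero in last position has no right neighbour \<open>B\<close>; there
  \<open>[\<dots>, C, A, 0] = [\<dots>, C, \<infinity>] = [\<dots>, C]\<close> (with \<open>1/0 = \<infinity>\<close> and \<open>1/\<infinity> = 0\<close>),
  which also shortens the word by two.  This last case is needed for
  \<open>\<phi>\<^sub>1\<^sup>(\<^sup>-\<^sup>1\<^sup>)([a\<^sub>0]) = [a\<^sub>0 - 1; 1, 0] = [a\<^sub>0 - 1]\<close>.
\<close>

fun remove_zeros :: "int list \<Rightarrow> int list" where
  "remove_zeros [] = []"
| "remove_zeros [a] = [a]"
| "remove_zeros [a, b] = (if b = 0 then [] else [a, b])"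
| "remove_zeros (a # b # c # w) =
     (if b = 0 then remove_zeros ((a + c) # w) else a # remove_zeros (b # c # w))"

definition fold_plus :: "int \<Rightarrow> int list \<Rightarrow> int list" where
  "fold_plus z c = (let a\<^sub>0 = hd c; a = tl c in
     remove_zeros (if a = [] then [a\<^sub>0, z - 1, 1]
                   else a\<^sub>0 # a @ [z - 1] @ rev (tilde a)))"

definition fold_minus :: "int \<Rightarrow> int list \<Rightarrow> int list" where
  "fold_minus z c = (let a\<^sub>0 = hd c; a = tl c in
     remove_zeros (if a = [] then [a\<^sub>0 - 1, 1, z - 1]
                   else a\<^sub>0 # tilde a @ [z - 1] @ rev a))"

text \<open>The sign \<open>s\<close> is meant to be \<open>1\<close> or \<open>-1\<close>.\<close>

definition cf_fold :: "int \<Rightarrow> int \<Rightarrow> int list \<Rightarrow> int list" where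
  "cf_fold z s c = (if s = 1 then fold_plus z c else fold_minus z c)"

text \<open>
  The sequence \<open>c\<close> gives the infinite regular continued fraction
  \<open>[c 0; c 1, c 2, \<dots>]\<close>, whose value is the limit of its convergents.
\<close>

definition is_cf_expansion :: "(nat \<Rightarrow> int) \<Rightarrow> real \<Rightarrow> bool" where
  "is_cf_expansion c r \<longleftrightarrow>
     (\<forall>i\<ge>1. c i > 0) \<and> (\<lambda>n. cf_value (map c [0..<Suc n])) \<longlonglongrightarrow> r"

text \<open>
  A sequence of finite continued fractions tends to an infinite one if every partial
  quotient is eventually present and stationary.
\<close>

definition cf_limit :: "(nat \<Rightarrow> int list) \<Rightarrow> (nat \<Rightarrow> int) \<Rightarrow> bool" where
  "cf_limit F c \<longleftrightarrow>
     (\<forall>i. eventually (\<lambda>n. i < length (F n) \<and> F n ! i = c i) sequentially)"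

end

theory Submission
  imports Defs
begin

text \<open>
  A word acts on column vectors as the product of the matrices with rows \<open>(a, 1)\<close> and \<open>(1, 0)\<close>
  over its letters; applied to \<open>(1, 0)\<close> this gives numerator and denominator of the continued
  fraction. Removing zeros does not change the result, reversal transposes the matrix, and the
  determinant is \<open>(-1)\<close> to the length, so folding a word with fraction \<open>P/Q\<close> gives exactly the
  pair \<open>(z Q P \<plusminus> 1, z Q\<^sup>2)\<close>. From the second step on all words have even length, which
  makes the sign of the fold the sign of the added term. A fold changes at most the last two
  letters of the existing word, and the words eventually grow, so every partial quotient
  stabilises. Continued fractions with a long common prefix have close values, which identifies
  the value of the limiting expansion.
\<close>

section \<open>Words acting on column vectors\<close>

text \<open>No division occurs, so words with zero letters can be evaluated as they stand; the
  vector \<open>(1, 0)\<close> represents infinity.\<close>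

fun cf_act :: "int list \<Rightarrow> int \<times> int \<Rightarrow> int \<times> int" where
  "cf_act [] v = v"
| "cf_act (a # w) v = (a * fst (cf_act w v) + snd (cf_act w v), fst (cf_act w v))"

lemma cf_act_append: "cf_act (u @ w) v = cf_act u (cf_act w v)"
  by (induction u) auto

lemma cf_act_linear:
  "cf_act w (s, t) = (s * fst (cf_act w (1, 0)) + t * fst (cf_act w (0, 1)),
                      s * snd (cf_act w (1, 0)) + t * snd (cf_act w (0, 1)))"
  by (induction w) (auto simp: algebra_simps)

text \<open>The matrix of each letter is symmetric, so reversing a word transposes its matrix; both
  sides are inner products.\<close>

lemma cf_act_adjoint:
  "fst (cf_act w u) * fst v + snd (cf_act w u) * snd v =
   fst u * fst (cf_act (rev w) v) + snd u * snd (cf_act (rev w) v)"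
proof (induction w arbitrary: v)
  case (Cons a w)
  show ?case using Cons.IH[of "cf_act [a] v"]
    by (simp add: cf_act_append algebra_simps)
qed simp

text \<open>The first column of the transpose is the first row, read off by pairing with the two
  unit vectors.\<close>

lemma cf_act_rev:
  "cf_act (rev w) (1, 0) = (fst (cf_act w (1, 0)), fst (cf_act w (0, 1)))"
  using cf_act_adjoint[of w "(1, 0)" "(1, 0)"] cf_act_adjoint[of w "(0, 1)" "(1, 0)"]
  by (auto simp: prod_eq_iff)

lemma cf_act_det:
  "fst (cf_act w (1, 0)) * snd (cf_act w (0, 1)) - snd (cf_act w (1, 0)) * fst (cf_act w (0, 1))
   = (-1) ^ length w"
proof (induction w)
  case (Cons a w)
  then show ?case by (simp add: algebra_simps)
qed simp

text \<open>Each letter is one step of the Euclidean algorithm run backwards.\<close>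

lemma cf_act_coprime: "coprime (fst (cf_act w (1, 0))) (snd (cf_act w (1, 0)))"
proof (induction w)
  case (Cons a w)
  then show ?case
    by (metis cf_act.simps(2) coprime_commute fst_conv gcd_add_mult mult.commute
        coprime_iff_gcd_eq_1 snd_conv add.commute)
qed simp

lemma cf_act_pos:
  assumes "\<forall>b\<in>set w. b > 0"
  shows "fst (cf_act w (1, 0)) > 0 \<and> snd (cf_act w (1, 0)) \<ge> 0"
  using assms by (induction w) (auto intro!: add_pos_nonneg)

lemma cf_value_cf_act:
  assumes "\<forall>b\<in>set w. b > 0"
  shows "cf_value (a # w) = fst (cf_act (a # w) (1, 0)) / snd (cf_act (a # w) (1, 0))"
  using assms
proof (induction w arbitrary: a)
  case (Cons b w)
  obtain X Y where XY: "cf_act (b # w) (1, 0) = (X, Y)" by fastforce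
  have "X > 0" "Y > 0"
    using cf_act_pos[OF Cons.prems] cf_act_pos[of w] Cons.prems XY by auto
  moreover have "cf_value (a # b # w) = a + 1 / (X / Y)"
    using Cons XY by (metis cf_value.simps(3) fst_conv list.set_intros(2) snd_conv)
  moreover have "cf_act (a # b # w) (1, 0) = (a * X + Y, X)"
    by (subst cf_act.simps(2)) (simp only: XY fst_conv snd_conv)
  ultimately show ?case
    by (simp add: field_simps del: cf_act.simps cf_value.simps)
qed simp

section \<open>Effect of folding on numerator and denominator\<close>

text \<open>Replacing the last letter \<open>l\<close> by \<open>l - 1, 1\<close> multiplies the
  matrix on the right by the one with rows \<open>(1, 1)\<close> and \<open>(0, -1)\<close>.\<close>

lemma cf_act_tilde:
  assumes "a \<noteq> []"
  shows "cf_act (tilde a) (s, t) = cf_act a (s + t, - t)"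
proof -
  obtain u l where "a = u @ [l]"
    using assms by (metis append_butlast_last_id)
  then show ?thesis
    by (simp add: tilde_def cf_act_append algebra_simps)
qed

text \<open>The letter 0 swaps the coordinates, so \<open>a, 0, c\<close> acts as
  \<open>a + c\<close>. A final \<open>a, 0\<close> fixes \<open>(1, 0)\<close> but not every
  vector, hence the restriction to \<open>(1, 0)\<close>.\<close>

lemma cf_act_remove_zeros: "cf_act (remove_zeros c) (1, 0) = cf_act c (1, 0)"
  by (induction c rule: remove_zeros.induct) (auto simp: algebra_simps)

text \<open>The pair is exact, not merely a ratio, so the denominator recursion can be iterated. The
  exponent counts the letters after the integer part.\<close>

lemma cf_act_fold:
  assumes "s \<in> {1, -1}" and "cf_act (h # w) (1, 0) = (P, Q)"
  shows "cf_act (cf_fold z s (h # w)) (1, 0) = (z * Q * P + s * (-1) ^ length w, z * Q\<^sup>2)"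
proof (cases "w = []")
  case True
  then show ?thesis using assms
    by (auto simp: cf_fold_def fold_plus_def fold_minus_def cf_act_remove_zeros algebra_simps)
next
  case False
  obtain A C where AC: "cf_act w (1, 0) = (A, C)" by fastforce
  obtain B D where BD: "cf_act w (0, 1) = (B, D)" by fastforce
  have lin: "cf_act w (u, v) = (u * A + v * B, u * C + v * D)" for u v
    by (subst cf_act_linear) (simp add: AC BD)
  have "cf_act (rev w) (1, 0) = (A, B)"
    by (simp add: cf_act_rev AC BD)
  moreover have "cf_act (rev (tilde w)) (1, 0) = (A, A - B)"
    by (simp add: cf_act_rev cf_act_tilde[OF False] lin)
  moreover have "(-1) ^ length w = A * D - C * B"
    using cf_act_det[of w] by (simp add: AC BD)
  moreover have "P = h * A + C" "Q = A"
    using assms(2) by (auto simp: AC)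
  \<comment> \<open>The vector reaching the left copy of \<open>w\<close> is
    \<open>(z A - B, A)\<close> for the plus fold and, after the \<open>tilde\<close> correction,
    \<open>(z A + B, - A)\<close> for the minus fold. Applying \<open>w\<close> leaves
    \<open>z A A\<close> on top and \<open>z A C\<close> plus or minus the determinant
    below.\<close>
  ultimately show ?thesis using assms(1) False
    by (auto simp: cf_fold_def fold_plus_def fold_minus_def cf_act_remove_zeros cf_act_append
        cf_act_tilde lin algebra_simps power2_eq_square simp del: rev.simps)
qed

section \<open>Zero removal and the shape of folded words\<close>

lemma remove_zeros_Cons: "x \<noteq> 0 \<Longrightarrow> remove_zeros (h # x # w) = h # remove_zeros (x # w)"
  by (cases w) auto

text \<open>Positive letters are never deleted, so \<open>x\<close> acts as the integer part of what
  follows it and removal is local to the middle of a fold.\<close>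

lemma remove_zeros_append:
  assumes "\<forall>b\<in>set u. b > 0" "x > 0"
  shows "remove_zeros (h # u @ x # w) = h # u @ remove_zeros (x # w)"
  using assms
proof (induction u arbitrary: h)
  case (Cons b u)
  then show ?case by (simp add: remove_zeros_Cons)
qed (simp add: remove_zeros_Cons)

lemma remove_zeros_pos:
  assumes "\<forall>b\<in>set w. b > 0"
  shows "remove_zeros (h # w) = h # w"
  using assms
  by (induction w arbitrary: h) (auto simp: remove_zeros_Cons)

text \<open>With \<open>z > 0\<close>, the only zeros a fold can create come from \<open>z = 1\<close> and from \<open>last a = 1\<close>.\<close>

lemma cf_fold_generic:
  assumes "\<forall>b\<in>set a. b > 0" "a \<noteq> []" "last a > 1" "z > 1"
  shows "cf_fold z s (h # a) =
    (if s = 1 then h # a @ (z - 1) # rev (tilde a) else h # tilde a @ (z - 1) # rev a)"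
proof -
  have "b > 0" if "b \<in> set (tilde a)" for b
    using that assms by (auto simp: tilde_def dest: in_set_butlastD)
  then show ?thesis using assms
    by (auto simp: cf_fold_def fold_plus_def fold_minus_def intro!: remove_zeros_pos)
qed

text \<open>Before removal the block between \<open>u\<close> and \<open>rev u\<close> is
  \<open>[l, z - 1, 1, l - 1]\<close> or its reversal. Its only possible zero is
  \<open>z - 1\<close>, and merging there leaves two letters.\<close>

lemma cf_fold_last_gt_1:
  assumes "\<forall>b\<in>set u. b > 0" "l > 1" "z > 0"
  shows "\<exists>v. cf_fold z s (h # u @ [l]) = h # u @ v @ rev u \<and>
    (\<forall>b\<in>set v. b > 0) \<and> (length v = 2 \<or> length v = 4)"
proof (cases "z = 1")
  case True
  have "remove_zeros (h # u @ l # 0 # 1 # (l - 1) # rev u) = h # u @ (l + 1) # (l - 1) # rev u"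
    using assms remove_zeros_pos[of "(l - 1) # rev u" "l + 1"] by (simp add: remove_zeros_append)
  moreover have "remove_zeros (h # u @ (l - 1) # 1 # 0 # l # rev u) = h # u @ (l - 1) # (l + 1) # rev u"
    using assms remove_zeros_pos[of "rev u" "l + 1"]
    by (simp add: remove_zeros_append remove_zeros_Cons add.commute)
  ultimately show ?thesis using assms True
    by (intro exI[of _ "if s = 1 then [l + 1, l - 1] else [l - 1, l + 1]"])
      (auto simp: cf_fold_def fold_plus_def fold_minus_def tilde_def)
next
  case False
  then show ?thesis using assms
    by (subst cf_fold_generic)
       (auto intro!: exI[of _ "if s = 1 then [l, z - 1, 1, l - 1] else [l - 1, 1, z - 1, l]"]
             simp: tilde_def)
qed

text \<open>Here \<open>tilde\<close> creates a zero for every \<open>z\<close>, so one merge always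
  shortens the six-letter middle block to four; \<open>z = 1\<close> forces a second merge. The
  two-letter results are kept explicit to exclude stagnation later.\<close>

lemma cf_fold_last_eq_1:
  assumes "\<forall>b\<in>set u. b > 0" "m > 0" "z > 0"
  shows "\<exists>v. cf_fold z s (h # u @ [m, 1]) = h # u @ v @ rev u \<and>
    (\<forall>b\<in>set v. b > 0) \<and> (v = [m, m + 2] \<or> v = [m + 2, m] \<or> length v = 4)"
proof (cases "z = 1")
  case True
  have "remove_zeros (h # u @ m # 1 # 0 # 1 # 0 # m # rev u) = h # u @ m # (m + 2) # rev u"
    using assms remove_zeros_pos[of "rev u" "m + 2"]
    by (simp add: remove_zeros_append remove_zeros_Cons add.commute)
  moreover have "remove_zeros (h # u @ m # 0 # 1 # 0 # 1 # m # rev u) = h # u @ (m + 2) # m # rev u"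
    using assms remove_zeros_pos[of "m # rev u" "m + 2"]
    by (simp add: remove_zeros_append add.commute)
  ultimately show ?thesis using assms True
    by (intro exI[of _ "if s = 1 then [m, m + 2] else [m + 2, m]"])
      (auto simp: cf_fold_def fold_plus_def fold_minus_def tilde_def butlast_append)
next
  case False
  then have z: "z > 1" using assms by simp
  have "remove_zeros (h # u @ m # 1 # (z - 1) # 1 # 0 # m # rev u)
      = h # u @ m # 1 # (z - 1) # (m + 1) # rev u"
    using assms z remove_zeros_pos[of "rev u" "m + 1"]
    by (simp add: remove_zeros_append remove_zeros_Cons add.commute)
  moreover have "remove_zeros (h # u @ m # 0 # 1 # (z - 1) # 1 # m # rev u)
      = h # u @ (m + 1) # (z - 1) # 1 # m # rev u"
    using assms z remove_zeros_pos[of "(z - 1) # 1 # m # rev u" "m + 1"]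
    by (simp add: remove_zeros_append)
  ultimately show ?thesis using assms z
    by (intro exI[of _ "if s = 1 then [m, 1, z - 1, m + 1] else [m + 1, z - 1, 1, m]"])
      (auto simp: cf_fold_def fold_plus_def fold_minus_def tilde_def butlast_append)
qed

text \<open>From length \<open>L\<close> the new length is at least \<open>2 L - 2\<close>, so 2 is
  the only positive even length at which growth can fail; the last clause pins down that case. The
  \<open>tilde\<close> of \<open>[1]\<close> begins with 0, which the integer part could absorb, so
  \<open>[1]\<close> is excluded.\<close>

lemma cf_fold_nonempty:
  assumes "\<forall>b\<in>set a. b > 0" "a \<noteq> []" "a \<noteq> [1]" "z > 0"
  obtains w where "cf_fold z s (h # a) = h # w" "\<forall>b\<in>set w. b > 0" "even (length w)"
    "w \<noteq> []" "2 * length a \<le> length w + 2"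
    "take (length a - 2) w = take (length a - 2) a"
    "length a = 2 \<Longrightarrow> length w = 2 \<Longrightarrow> \<exists>m. a = [m, 1] \<and> (w = [m, m + 2] \<or> w = [m + 2, m])"
proof (cases "last a = 1")
  case True
  obtain u' where "a = u' @ [1]"
    using assms(2) True by (metis append_butlast_last_id)
  moreover obtain u m where "u' = u @ [m]"
    using assms(3) calculation by (cases u' rule: rev_cases) auto
  ultimately have a: "a = u @ [m, 1]" by simp
  then obtain v where "cf_fold z s (h # a) = h # u @ v @ rev u" "\<forall>b\<in>set v. b > 0"
    "v = [m, m + 2] \<or> v = [m + 2, m] \<or> length v = 4"
    using cf_fold_last_eq_1[of u m z s h] assms by auto
  then show ?thesis using assms a
    by (intro that[of "u @ v @ rev u"]) auto
next
  case False
  then have "last a > 1"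
    using assms last_in_set[of a] by (metis int_one_le_iff_zero_less order_le_less)
  moreover obtain u l where a: "a = u @ [l]"
    using assms(2) by (metis append_butlast_last_id)
  ultimately obtain v where "cf_fold z s (h # a) = h # u @ v @ rev u" "\<forall>b\<in>set v. b > 0"
    "length v = 2 \<or> length v = 4"
    using cf_fold_last_gt_1[of u l z s h] assms by auto
  then show ?thesis using assms a
    by (intro that[of "u @ v @ rev u"]) auto
qed

text \<open>The integer part can move here: for \<open>z = 1\<close> the word stays empty and the
  integer changes by 1, and for \<open>z > 1\<close> the minus fold gives
  \<open>h - 1\<close>.\<close>

lemma cf_fold_empty:
  assumes "z > 0"
  obtains h' w where "cf_fold z s [h] = h' # w" "\<forall>b\<in>set w. b > 0" "even (length w)"
proof (cases "z = 1")
  case True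
  then show ?thesis
    using that[of "if s = 1 then h + 1 else h - 1" "[]"]
    by (auto simp: cf_fold_def fold_plus_def fold_minus_def split: if_splits)
next
  case False
  then show ?thesis using assms
    that[of "if s = 1 then h else h - 1" "if s = 1 then [z - 1, 1] else [1, z - 1]"]
    by (auto simp: cf_fold_def fold_plus_def fold_minus_def split: if_splits)
qed

section \<open>Common prefixes and limits of continued fractions\<close>

lemma cf_value_ge_1:
  assumes "w \<noteq> []" "\<forall>b\<in>set w. b > 0"
  shows "cf_value w \<ge> 1"
  using assms
proof (induction w rule: cf_value.induct)
  case (3 a b w)
  then have "cf_value (b # w) \<ge> 1" "a \<ge> 1" by auto
  then have "0 \<le> 1 / cf_value (b # w)" "1 \<le> real_of_int a" by auto
  then show ?case unfolding cf_value.simps by linarith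
qed auto

text \<open>A shared pair of letters \<open>a, b\<close> turns tail values \<open>X\<close>,
  \<open>Y\<close> into values differing by \<open>(X - Y) / ((b X + 1) (b Y + 1))\<close>, at most
  a quarter of the old distance. A single letter gives no uniform factor below 1, so the exponent
  counts pairs.\<close>

lemma cf_value_prefix_dist:
  assumes "u \<noteq> []" "\<forall>b\<in>set (tl (u @ v)). b > 0"
  shows "\<bar>cf_value (u @ v) - cf_value u\<bar> \<le> (1 / 4) ^ ((length u - 1) div 2)"
  using assms
proof (induction "length u" arbitrary: u rule: less_induct)
  case less
  consider a where "u = [a]" | a b where "u = [a, b]" | a b c w where "u = a # b # c # w"
    using less.prems(1) by (metis list.exhaust)
  then show ?case
  proof cases
    case 1
    show ?thesis
    proof (cases v)
      case (Cons c v')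
      then have "cf_value v \<ge> 1" using less.prems 1 by (intro cf_value_ge_1) auto
      then show ?thesis using 1 Cons by simp
    qed (use 1 in simp)
  next
    case 2
    have b: "b \<ge> 1" using less.prems 2 by auto
    have "cf_value (b # v) \<ge> 1" using less.prems 2 by (intro cf_value_ge_1) auto
    then have "0 \<le> 1 / cf_value (b # v)" "1 / cf_value (b # v) \<le> 1"
      "0 \<le> 1 / real_of_int b" "1 / real_of_int b \<le> 1"
      using b by auto
    then have "\<bar>1 / cf_value (b # v) - 1 / real_of_int b\<bar> \<le> 1" by linarith
    then show ?thesis using 2 by simp
  next
    case 3
    let ?X = "cf_value (c # w @ v)" and ?Y = "cf_value (c # w)"
    have X: "?X \<ge> 1" and Y: "?Y \<ge> 1" and b: "real_of_int b \<ge> 1"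
      using less.prems 3 cf_value_ge_1[of "c # w @ v"] cf_value_ge_1[of "c # w"] by auto
    have "1 * 1 \<le> b * ?X" "1 * 1 \<le> b * ?Y"
      using X Y b by (intro mult_mono; linarith)+
    then have bX: "b * ?X \<ge> 1" and bY: "b * ?Y \<ge> 1"
      by auto
    have "2 * 2 \<le> (b * ?X + 1) * (b * ?Y + 1)"
      using bX bY by (intro mult_mono) auto
    have "1 / (b + 1 / ?X) - 1 / (b + 1 / ?Y) = (?X - ?Y) / ((b * ?X + 1) * (b * ?Y + 1))"
    proof -
      have "1 / (b + 1 / ?X) = ?X / (b * ?X + 1)" "1 / (b + 1 / ?Y) = ?Y / (b * ?Y + 1)"
        using X Y bX bY by (auto simp: field_simps)
      moreover have "b * ?X + 1 \<noteq> 0" "b * ?Y + 1 \<noteq> 0" using bX bY by linarith+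
      ultimately show ?thesis by (simp add: diff_frac_eq algebra_simps)
    qed
    then have "\<bar>cf_value (u @ v) - cf_value u\<bar> = \<bar>?X - ?Y\<bar> / \<bar>(b * ?X + 1) * (b * ?Y + 1)\<bar>"
      using 3 by (simp add: abs_divide)
    also have "\<dots> \<le> \<bar>?X - ?Y\<bar> / 4"
      using \<open>2 * 2 \<le> (b * ?X + 1) * (b * ?Y + 1)\<close> by (intro divide_left_mono) auto
    also have "\<dots> \<le> (1 / 4) ^ ((length (c # w) - 1) div 2) / 4"
      using less.hyps[of "c # w"] less.prems 3 by simp
    also have "\<dots> = (1 / 4) ^ ((length u - 1) div 2)"
      using 3 by simp
    finally show ?thesis .
  qed
qed

text \<open>For fixed \<open>n\<close> the first \<open>n + 1\<close> quotients of \<open>c\<close>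
  form a prefix of \<open>F m\<close> for all large \<open>m\<close>. Letting \<open>m\<close> grow
  turns the prefix bound into a bound on the distance from \<open>S\<close> to the
  convergent.\<close>

lemma cf_value_limit:
  assumes F: "\<And>n. n \<ge> N \<Longrightarrow> regular_cf (F n)" and lim: "cf_limit F c"
    and S: "(\<lambda>n. cf_value (F n)) \<longlonglongrightarrow> S"
  shows "is_cf_expansion c S"
proof -
  have evN: "\<forall>\<^sub>F n in sequentially. n \<ge> N" by (rule eventually_ge_at_top)
  have "c i > 0" if "i \<ge> 1" for i
  proof -
    have "\<forall>\<^sub>F n in sequentially. n \<ge> N \<and> i < length (F n) \<and> F n ! i = c i"
      using lim evN unfolding cf_limit_def by (auto intro: eventually_conj)
    then obtain n where n: "n \<ge> N" "i < length (F n)" "F n ! i = c i"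
      by (auto simp: eventually_sequentially)
    have "F n ! i = tl (F n) ! (i - 1)" "i - 1 < length (tl (F n))"
      using n that by (auto simp: nth_tl)
    then have "F n ! i \<in> set (tl (F n))" by simp
    then show ?thesis using F[OF n(1)] n(3) by (auto simp: regular_cf_def)
  qed
  moreover have "(\<lambda>n. cf_value (map c [0..<Suc n])) \<longlonglongrightarrow> S"
  proof -
    have dist: "\<bar>S - cf_value (map c [0..<Suc n])\<bar> \<le> (1 / 4) ^ (n div 2)" for n
    proof -
      let ?u = "map c [0..<Suc n]"
      have "\<forall>\<^sub>F m in sequentially. \<forall>i\<in>{..n}. i < length (F m) \<and> F m ! i = c i"
        using lim unfolding cf_limit_def by (intro eventually_ball_finite) auto
      then have "\<forall>\<^sub>F m in sequentially. \<bar>cf_value (F m) - cf_value ?u\<bar> \<le> (1 / 4) ^ (n div 2)"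
        using evN
      proof eventually_elim
        case (elim m)
        have "take (Suc n) (F m) = ?u"
        proof (rule nth_equalityI)
          show "length (take (Suc n) (F m)) = length ?u" using elim(1) by auto
        next
          fix i assume "i < length (take (Suc n) (F m))"
          then show "take (Suc n) (F m) ! i = ?u ! i"
            using elim(1) by (auto simp del: upt_Suc)
        qed
        then have "F m = ?u @ drop (Suc n) (F m)"
          by (metis append_take_drop_id)
        then show ?case
          using cf_value_prefix_dist[of ?u "drop (Suc n) (F m)"] F[OF elim(2)]
          by (simp add: regular_cf_def del: upt_Suc)
      qed
      then show ?thesis
        by (intro tendsto_upperbound[OF tendsto_rabs[OF tendsto_diff[OF S tendsto_const]]]) auto
    qed
    have "filterlim (\<lambda>n. n div 2 :: nat) sequentially sequentially"
      unfolding filterlim_at_top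
    proof
      fix Z :: nat
      show "\<forall>\<^sub>F n in sequentially. Z \<le> n div 2"
        by (rule eventually_sequentiallyI[of "2 * Z"]) simp
    qed
    then have "(\<lambda>n. (1 / 4 :: real) ^ (n div 2)) \<longlonglongrightarrow> 0"
      by (rule filterlim_compose[OF LIMSEQ_realpow_zero, rotated 2]) auto
    then have "(\<lambda>n. cf_value (map c [0..<Suc n]) - S) \<longlonglongrightarrow> 0"
      by (rule tendsto_0_le[where K = 1])
        (use dist in \<open>auto simp: abs_minus_commute simp del: upt_Suc\<close>)
    then show ?thesis by (simp add: LIM_zero_iff del: upt_Suc)
  qed
  ultimately show ?thesis by (simp add: is_cf_expansion_def)
qed

section \<open>Stabilisation of partial quotients\<close>

text \<open>A nonempty word of even length is never \<open>[1]\<close> and has at least two letters,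
  so the integer part stays \<open>h\<close>. Once lengths increase strictly, every position
  eventually lies in the part that folds leave unchanged.\<close>

lemma cf_limit_fold:
  assumes fold: "\<And>n. n \<ge> M \<Longrightarrow> \<exists>s. F (n + 1) = cf_fold (z n) s (F n)"
    and z: "\<And>n. n \<ge> M \<Longrightarrow> z n > 0"
    and start: "F M = h # w" "\<forall>b\<in>set w. b > 0" "w \<noteq> []" "even (length w)"
  shows "\<exists>c. cf_limit F c"
proof -
  have inv: "\<exists>w. F n = h # w \<and> (\<forall>b\<in>set w. b > 0) \<and> w \<noteq> [] \<and> even (length w)"
    if "n \<ge> M" for n
    using that
  proof (induction n rule: dec_induct)
    case base
    then show ?case using start by blast
  next
    case (step n)
    then obtain w where w: "F n = h # w" "\<forall>b\<in>set w. b > 0" "w \<noteq> []" "even (length w)" by blast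
    then have "w \<noteq> [1]" by auto
    then show ?case
      using fold[OF step(1)] z[OF step(1)] w cf_fold_nonempty[of w "z n" _ h]
      by (metis Suc_eq_plus1)
  qed
  define W where "W n = tl (F n)" for n
  have W: "F n = h # W n" "\<forall>b\<in>set (W n). b > 0" "W n \<noteq> []" "W n \<noteq> [1]" "length (W n) \<ge> 2"
    if n: "n \<ge> M" for n
  proof -
    obtain w where w: "F n = h # w" "\<forall>b\<in>set w. b > 0" "w \<noteq> []" "even (length w)"
      using inv[OF n] by blast
    then show "F n = h # W n" "\<forall>b\<in>set (W n). b > 0" "W n \<noteq> []" "W n \<noteq> [1]"
      by (auto simp: W_def)
    have "length w \<ge> 2" using w by (cases w rule: cf_value.cases) auto
    then show "length (W n) \<ge> 2" using w(1) by (simp add: W_def)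
  qed
  have next_word: "2 * length (W n) \<le> length (W (Suc n)) + 2"
    "take (length (W n) - 2) (W (Suc n)) = take (length (W n) - 2) (W n)"
    "length (W n) = 2 \<Longrightarrow> length (W (Suc n)) = 2 \<Longrightarrow>
       \<exists>m. W n = [m, 1] \<and> (W (Suc n) = [m, m + 2] \<or> W (Suc n) = [m + 2, m])"
    if n: "n \<ge> M" for n
  proof -
    obtain s where s: "F (Suc n) = cf_fold (z n) s (h # W n)"
      using fold[OF n] W(1)[OF n] by auto
    obtain w where w: "cf_fold (z n) s (h # W n) = h # w"
      "2 * length (W n) \<le> length w + 2"
      "take (length (W n) - 2) w = take (length (W n) - 2) (W n)"
      "length (W n) = 2 \<Longrightarrow> length w = 2 \<Longrightarrow>
         \<exists>m. W n = [m, 1] \<and> (w = [m, m + 2] \<or> w = [m + 2, m])"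
      by (rule cf_fold_nonempty[OF W(2)[OF n] W(3)[OF n] W(4)[OF n] z[OF n], of s h]) blast
    have "W (Suc n) = w" using s w(1) by (simp add: W_def)
    then show "2 * length (W n) \<le> length (W (Suc n)) + 2"
      "take (length (W n) - 2) (W (Suc n)) = take (length (W n) - 2) (W n)"
      "length (W n) = 2 \<Longrightarrow> length (W (Suc n)) = 2 \<Longrightarrow>
         \<exists>m. W n = [m, 1] \<and> (W (Suc n) = [m, m + 2] \<or> W (Suc n) = [m + 2, m])"
      using w by auto
  qed
  have "\<exists>K\<ge>M. length (W K) \<ge> 3"
  proof (rule ccontr)
    \<comment> \<open>A word can keep length 2 only along (1, 1), (3, 1) and then (3, 5) or (5, 3).\<close>
    assume "\<not> ?thesis"
    then have "length (W n) = 2" if "n \<ge> M" for n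
      using that W(5)[OF that] by (metis eval_nat_numeral(3) le_antisym not_less_eq_eq)
    then have *: "\<exists>m. W n = [m, 1] \<and> (W (Suc n) = [m, m + 2] \<or> W (Suc n) = [m + 2, m])"
      if "n \<ge> M" for n using that next_word(3) by simp
    have "\<forall>b\<in>set (W M). b > 0" by (rule W(2)[OF order_refl])
    then show False
      using *[of M] *[of "Suc M"] *[of "Suc (Suc M)"] by auto
  qed
  then obtain K where K: "K \<ge> M" "length (W K) \<ge> 3" by blast
  \<comment> \<open>\<open>2 L - 2 \<ge> L + 1\<close> as soon as \<open>L \<ge> 3\<close>.\<close>
  have len: "length (W n) \<ge> 3 + (n - K)" if "n \<ge> K" for n
    using that
  proof (induction n rule: dec_induct)
    case (step n)
    then show ?case using \<open>K \<ge> M\<close> next_word(1)[of n] by simp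
  qed (use K in simp)
  \<comment> \<open>For \<open>n \<ge> K + i\<close> the word has at least \<open>i + 3\<close>
    letters, so position \<open>i\<close> avoids the last two, the only ones a fold can
    alter.\<close>
  have "F n ! i = F (K + i) ! i" if "n \<ge> K + i" for n i
    using that
  proof (induction n rule: dec_induct)
    case (step n)
    have "n \<ge> M" "Suc n \<ge> M" using step K by auto
    show ?case
    proof (cases i)
      case 0
      then show ?thesis using step.IH W(1)[OF \<open>n \<ge> M\<close>] W(1)[OF \<open>Suc n \<ge> M\<close>] by simp
    next
      case (Suc j)
      have "j < length (W n) - 2" using len[of n] step(1) Suc by simp
      then have "W (Suc n) ! j = W n ! j"
        using next_word(2)[OF \<open>n \<ge> M\<close>] by (metis nth_take)
      then show ?thesis using step.IH W(1)[OF \<open>n \<ge> M\<close>] W(1)[OF \<open>Suc n \<ge> M\<close>] Suc by simp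
    qed
  qed simp
  moreover have "i < length (F n)" if "n \<ge> K + i" for n i
    using len[of n] W(1)[of n] K that by simp
  ultimately have "cf_limit F (\<lambda>i. F (K + i) ! i)"
    unfolding cf_limit_def eventually_sequentially by blast
  then show ?thesis by blast
qed

section \<open>Lengths of folds without zero quotients\<close>

text \<open>The hypotheses reproduce themselves: the new word begins and ends with the first letter
  of \<open>a\<close> or of \<open>tilde a\<close>. These agree unless \<open>a\<close> has one
  letter, which \<open>tilde\<close> lowers by 1; hence the bound 2 in that case.\<close>

lemma cf_fold_length:
  assumes "\<forall>b\<in>set a. b > 0" "a \<noteq> []" "last a > 1" "hd a > 1" "length a = 1 \<longrightarrow> hd a > 2" "z > 1"
  obtains w where "cf_fold z s (h # a) = h # w" "\<forall>b\<in>set w. b > 0" "last w > 1" "hd w > 1"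
    "length w = 2 * length a + 2"
proof -
  obtain u l where a: "a = u @ [l]"
    using assms(2) by (metis append_butlast_last_id)
  show ?thesis
    using assms a cf_fold_generic[OF assms(1,2,3,6), of s h]
    by (intro that[of "if s = 1 then a @ (z - 1) # rev (tilde a) else tilde a @ (z - 1) # rev a"])
      (cases u; auto simp: tilde_def)+
qed

section \<open>Strong Engel series as iterated folds\<close>

theorem theorem2p2:
  fixes p q a\<^sub>0 :: int and a :: "int list" and k :: nat
    and x z \<epsilon> :: "nat \<Rightarrow> int" and S :: real and \<Phi> :: "nat \<Rightarrow> int list"
  assumes "coprime p q" and "q > 0"
    and "regular_cf (a\<^sub>0 # a)" and "cf_value (a\<^sub>0 # a) = of_int p / of_int q"
    and "if (of_int p / of_int q :: real) \<in> \<int> then a = [] else a \<noteq> [] \<and> last a > 1"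
    and "k = length a"
    and "\<forall>n\<ge>1. x n > 0" and "x 1 = q"
    and "\<forall>n\<ge>1. (x n)\<^sup>2 dvd x (n + 1)"
    and "\<forall>j\<ge>2. z j = x j div (x (j - 1))\<^sup>2"
    and "\<forall>j\<ge>2. \<epsilon> j \<in> {1, -1}"
    and "summable (\<lambda>n. of_int (\<epsilon> (n + 2)) / of_int (x (n + 2)) :: real)"
    and "S = of_int p / of_int q + (\<Sum>n. of_int (\<epsilon> (n + 2)) / of_int (x (n + 2)))"
    and "\<Phi> 1 = a\<^sub>0 # a"
    and "\<Phi> 2 = cf_fold (z 2) (\<epsilon> 2 * (-1) ^ k) (\<Phi> 1)"
    and "\<forall>n\<ge>2. \<Phi> (n + 1) = cf_fold (z (n + 1)) (\<epsilon> (n + 1)) (\<Phi> n)"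
  shows "(\<forall>n\<ge>1. regular_cf (\<Phi> n) \<and>
             of_int p / of_int q + (\<Sum>j=2..n. of_int (\<epsilon> j) / of_int (x j)) = cf_value (\<Phi> n))
       \<and> (\<lambda>n. cf_value (\<Phi> n)) \<longlonglongrightarrow> S
       \<and> (\<exists>c. is_cf_expansion c S \<and> cf_limit \<Phi> c)
       \<and> (k > 0 \<and> (\<forall>j\<ge>2. z j > 1) \<and> (k = 1 \<longrightarrow> a ! 0 > 2) \<and> (k \<ge> 2 \<longrightarrow> a ! 0 > 1)
            \<longrightarrow> (\<forall>n\<ge>1. cf_length (\<Phi> n) = (k + 2) * 2 ^ (n - 1) - 2))"
proof -
  have xz: "z (Suc n) > 0" "x (Suc n) = z (Suc n) * (x n)\<^sup>2" if "n \<ge> 1" for n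
  proof -
    have "x n > 0" "x (Suc n) > 0" using assms(7) that by auto
    have "(x n)\<^sup>2 dvd x (Suc n)" using assms(9) that by auto
    moreover have "z (Suc n) = x (Suc n) div (x n)\<^sup>2" using assms(10) that by auto
    ultimately show "x (Suc n) = z (Suc n) * (x n)\<^sup>2" by simp
    then show "z (Suc n) > 0"
      using \<open>x (Suc n) > 0\<close> \<open>x n > 0\<close> by (metis zero_less_mult_pos2 zero_less_power)
  qed
  define T where "T n = of_int p / of_int q + (\<Sum>j=2..n. of_int (\<epsilon> j) / of_int (x j) :: real)" for n
  \<comment> \<open>Absorbing the factor \<open>(-1) ^ k\<close> of the first fold gives one
    recursion for all folds.\<close>
  define s where "s n = (if n = 2 then \<epsilon> 2 * (-1) ^ k else \<epsilon> n)" for n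
  have s: "s (Suc n) \<in> {1, -1}" if "n \<ge> 1" for n
  proof -
    have "\<epsilon> (Suc n) \<in> {1, -1}" using assms(11) that by simp
    then show ?thesis by (cases "even k") (auto simp: s_def numeral_2_eq_2)
  qed
  have fold: "\<Phi> (Suc n) = cf_fold (z (Suc n)) (s (Suc n)) (\<Phi> n)" if "n \<ge> 1" for n
    using assms(15,16) that by (cases "n = 1") (auto simp: s_def numeral_2_eq_2)
  \<comment> \<open>The denominator must be exactly \<open>x n\<close>, because the next fold
    squares it and multiplies by \<open>z (Suc n)\<close>.\<close>
  have inv: "\<exists>h w. \<Phi> n = h # w \<and> (\<forall>b\<in>set w. b > 0) \<and> w \<noteq> [1] \<and>
      (if n = 1 then length w = k else even (length w)) \<and>
      snd (cf_act (\<Phi> n) (1, 0)) = x n \<and> cf_value (\<Phi> n) = T n" if "n \<ge> 1" for n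
    using that
  proof (induction n rule: dec_induct)
    case base
    obtain P Q where PQ: "cf_act (a\<^sub>0 # a) (1, 0) = (P, Q)" by fastforce
    have a: "\<forall>b\<in>set a. b > 0" using assms(3) by (simp add: regular_cf_def)
    have "coprime P Q" using cf_act_coprime[of "a\<^sub>0 # a"] by (simp only: PQ fst_conv snd_conv)
    have "Q > 0" using cf_act_pos[OF a] PQ by auto
    have "real_of_int P / real_of_int Q = real_of_int p / real_of_int q"
      using cf_value_cf_act[OF a, of a\<^sub>0] assms(4) PQ by (metis fst_conv snd_conv)
    then have "real_of_int (P * q) = real_of_int (p * Q)"
      using \<open>Q > 0\<close> \<open>q > 0\<close> by (simp add: field_simps)
    then have eq: "P * q = p * Q" by linarith
    \<comment> \<open>Both fractions are in lowest terms, so each denominator divides the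
      other.\<close>
    have "Q dvd q" using eq \<open>coprime P Q\<close>
      by (metis coprime_commute coprime_dvd_mult_right_iff dvd_triv_right)
    moreover have "q dvd Q" using eq \<open>coprime p q\<close>
      by (metis coprime_commute coprime_dvd_mult_right_iff dvd_triv_right)
    ultimately have "Q = q" using \<open>Q > 0\<close> \<open>q > 0\<close> by (simp add: zdvd_antisym_nonneg)
    moreover have "a \<noteq> [1]" using assms(5) by (auto split: if_splits)
    moreover have "T 1 = of_int p / of_int q" by (simp add: T_def)
    ultimately show ?case
      using PQ a assms(4,6,8,14) by simp
  next
    case (step n)
    obtain h w where w: "\<Phi> n = h # w" "\<forall>b\<in>set w. b > 0" "w \<noteq> [1]"
      "if n = 1 then length w = k else even (length w)"
      "snd (cf_act (\<Phi> n) (1, 0)) = x n" "cf_value (\<Phi> n) = T n"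
      using step.IH by blast
    have zx: "z (Suc n) > 0" "x (Suc n) = z (Suc n) * (x n)\<^sup>2" "x n > 0"
      using xz[OF step(1)] assms(7) step(1) by auto
    obtain h' w' where w': "\<Phi> (Suc n) = h' # w'" "\<forall>b\<in>set w'. b > 0" "even (length w')"
    proof (cases "w = []")
      case True
      then show ?thesis
        using cf_fold_empty[OF zx(1), of "s (Suc n)" h] that fold[OF step(1)] w(1) by metis
    next
      case False
      then show ?thesis
        using cf_fold_nonempty[OF w(2) False w(3) zx(1), of "s (Suc n)" h] that
          fold[OF step(1)] w(1) by metis
    qed
    obtain P where P: "cf_act (h # w) (1, 0) = (P, x n)"
      using w(1,5) by (metis prod.collapse)
    \<comment> \<open>For \<open>n = 1\<close> the two factors \<open>(-1) ^ k\<close> cancel;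
      afterwards the length is even.\<close>
    have sgn: "s (Suc n) * (-1) ^ length w = \<epsilon> (Suc n)"
      using w(4) by (auto simp: s_def numeral_2_eq_2 split: if_splits)
    have act: "cf_act (\<Phi> (Suc n)) (1, 0) = (z (Suc n) * x n * P + \<epsilon> (Suc n), x (Suc n))"
      using cf_act_fold[OF s[OF step(1)] P, of "z (Suc n)"] fold[OF step(1)] w(1) sgn zx(2) by simp
    have "T n = P / x n"
      using cf_value_cf_act[OF w(2), of h] w(1,6) P by (metis fst_conv snd_conv)
    then have "cf_value (\<Phi> (Suc n)) = T n + \<epsilon> (Suc n) / x (Suc n)"
      using cf_value_cf_act[OF w'(2), of h'] w'(1) act zx
      by (simp add: field_simps power2_eq_square del: cf_act.simps)
    also have "\<dots> = T (Suc n)"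
      using step(1) by (simp add: T_def)
    finally show ?case
      using w' act step(1) by auto
  qed
  have regular: "regular_cf (\<Phi> n)" "cf_value (\<Phi> n) = T n" if "n \<ge> 1" for n
    using inv[OF that] by (auto simp: regular_cf_def)
  have lim: "(\<lambda>n. cf_value (\<Phi> n)) \<longlonglongrightarrow> S"
  proof -
    let ?f = "\<lambda>n. of_int (\<epsilon> (n + 2)) / of_int (x (n + 2)) :: real"
    have "T (Suc n) = of_int p / of_int q + (\<Sum>i<n. ?f i)" for n
      by (induction n) (auto simp: T_def)
    moreover have "(\<lambda>n. of_int p / of_int q + (\<Sum>i<n. ?f i)) \<longlonglongrightarrow> S"
      unfolding assms(13) by (intro tendsto_intros summable_LIMSEQ assms(12))
    ultimately have "(\<lambda>n. cf_value (\<Phi> (Suc n))) \<longlonglongrightarrow> S"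
      using regular(2) by simp
    then show ?thesis by (rule LIMSEQ_imp_Suc)
  qed
  \<comment> \<open>Convergence prevents all terms from having absolute value 1. A denominator other
    than 1 then forces a nonempty word, from which stabilisation can start.\<close>
  have "\<exists>N\<ge>2. x N \<noteq> 1"
  proof (rule ccontr)
    assume "\<not> ?thesis"
    then have "\<bar>of_int (\<epsilon> (n + 2)) / of_int (x (n + 2)) :: real\<bar> = 1" for n
      using assms(11) by (auto dest!: spec[of _ "n + 2"])
    then have "(\<lambda>n. 1 :: real) \<longlonglongrightarrow> \<bar>0\<bar>"
      using tendsto_rabs[OF summable_LIMSEQ_zero[OF assms(12)]] by (simp only:)
    then show False
      by (simp add: LIMSEQ_const_iff)
  qed
  then obtain N where N: "N \<ge> 2" "x N \<noteq> 1" by blast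
  obtain h w where w: "\<Phi> N = h # w" "\<forall>b\<in>set w. b > 0" "even (length w)"
      "snd (cf_act (\<Phi> N) (1, 0)) = x N"
    using inv[of N] N(1) by (auto split: if_splits)
  then have "w \<noteq> []" using N(2) by auto
  then have "\<exists>c. cf_limit \<Phi> c"
    using w N(1) xz(1) fold
    by (intro cf_limit_fold[where M = N and F = \<Phi> and z = "\<lambda>n. z (Suc n)"]) auto
  then have expansion: "\<exists>c. is_cf_expansion c S \<and> cf_limit \<Phi> c"
    using cf_value_limit[where N = 1 and F = \<Phi>] regular(1) lim by blast
  have "cf_length (\<Phi> n) = (k + 2) * 2 ^ (n - 1) - 2"
    if "k > 0" and z1: "\<forall>j\<ge>2. z j > 1" and k1: "k = 1 \<longrightarrow> a ! 0 > 2" and k2: "k \<ge> 2 \<longrightarrow> a ! 0 > 1"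
      and "n \<ge> 1" for n
  proof -
    \<comment> \<open>Adding 2 turns the step from \<open>L\<close> to \<open>2 L + 2\<close> into
      doubling and avoids truncated subtraction.\<close>
    have "\<exists>w. \<Phi> n = a\<^sub>0 # w \<and> (\<forall>b\<in>set w. b > 0) \<and> w \<noteq> [] \<and> last w > 1 \<and> hd w > 1 \<and>
        (length w = 1 \<longrightarrow> hd w > 2) \<and> length w + 2 = (k + 2) * 2 ^ (n - 1)"
      using \<open>n \<ge> 1\<close>
    proof (induction n rule: dec_induct)
      case base
      have "a \<noteq> []" "hd a = a ! 0" using \<open>k > 0\<close> assms(6) by (auto simp: hd_conv_nth)
      moreover have "hd a > 1" using calculation k1 k2 \<open>k > 0\<close> by (cases "k = 1") auto
      moreover have "last a > 1" using assms(5) \<open>a \<noteq> []\<close> by (auto split: if_splits)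
      ultimately show ?case
        using assms(3,6,14) k1 by (auto simp: regular_cf_def)
    next
      case (step n)
      then obtain w where w: "\<Phi> n = a\<^sub>0 # w" "\<forall>b\<in>set w. b > 0" "w \<noteq> []" "last w > 1" "hd w > 1"
        "length w = 1 \<longrightarrow> hd w > 2" "length w + 2 = (k + 2) * 2 ^ (n - 1)" by blast
      have "z (Suc n) > 1" using z1 step(1) by simp
      then obtain w' where w': "\<Phi> (Suc n) = a\<^sub>0 # w'" "\<forall>b\<in>set w'. b > 0" "last w' > 1" "hd w' > 1"
        "length w' = 2 * length w + 2"
        using cf_fold_length[OF w(2-6), of "z (Suc n)" "s (Suc n)" a\<^sub>0] fold[OF step(1)] w(1) by metis
      have "length w' + 2 = 2 * (length w + 2)" using w' by simp
      also have "\<dots> = (k + 2) * 2 ^ (Suc n - 1)"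
        using w(7) step(1) by (cases n) simp_all
      finally show ?case using w' by auto
    qed
    then show ?thesis by (auto simp: cf_length_def)
  qed
  then show ?thesis
    using regular lim expansion unfolding T_def by auto
qed

end
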